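(* Let $f\colon\mathbb{R}\to\mathbb{R}$ be convex with $C=\{x\in\mathbb{R}: f(x)\le0\}\neq\varnothing$. Then $f$ has the decreasing property.
   Context: For a selection $s$ of the convex subdifferential $\partial f$ (i.e., $s(x)\in\partial f(x)$ for all $x$), set $G_{s}(x)=x-\frac{f(x)}{|s(x)|^2}s(x)$ if $f(x)>0$, and $G_{s}(x)=x$ otherwise, and set $\mathcal{G}(x)=\{G_{s}(x): s\text{ is a selection of }\partial f\}$. The function $f$ has the decreasing property if $\sup f(\mathcal{G}(x))\le f(x)$ for all $x\in \mathbb{R}$. *)

theory Defs
  imports "HOL-Analysis.Analysis"
begin

definition subdifferential :: "(real \<Rightarrow> real) \<Rightarrow> real \<Rightarrow> real set" where
  "subdifferential f x = {u. \<forall>y. f x + u * (y - x) \<le> f y}"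

definition subdiff_selection :: "(real \<Rightarrow> real) \<Rightarrow> (real \<Rightarrow> real) \<Rightarrow> bool" where
  "subdiff_selection f s \<longleftrightarrow> (\<forall>x. s x \<in> subdifferential f x)"

(* If f takes a value \<le> 0 somewhere, then 0 is not a subgradient at any x with f x > 0,
   so for selections s the division below is never by zero. *)
definition subgrad_projector :: "(real \<Rightarrow> real) \<Rightarrow> (real \<Rightarrow> real) \<Rightarrow> real \<Rightarrow> real" where
  "subgrad_projector f s x = (if f x > 0 then x - f x / \<bar>s x\<bar>\<^sup>2 * s x else x)"

definition subgrad_projections :: "(real \<Rightarrow> real) \<Rightarrow> real \<Rightarrow> real set" where
  "subgrad_projections f x = {subgrad_projector f s x |s. subdiff_selection f s}"

(* The supremum is taken in the extended reals: Sup on type real is unspecified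
   for sets that are not bounded above. *)
definition decreasing_property :: "(real \<Rightarrow> real) \<Rightarrow> bool" where
  "decreasing_property f \<longleftrightarrow>
     (\<forall>x. (SUP y\<in>subgrad_projections f x. ereal (f y)) \<le> ereal (f x))"

end

theory Submission
  imports Defs
begin

text \<open>If \<open>f c \<le> 0 < f x\<close>, the subgradient inequality gives \<open>f x \<le> s x * (x - c)\<close>, so the
  projector moves \<open>x\<close> towards \<open>c\<close> without passing it. Convexity bounds \<open>f\<close> on the segment
  by its larger endpoint value \<open>f x\<close>.\<close>

lemma subgrad_step_le:
  fixes f :: "real \<Rightarrow> real"
  assumes conv: "convex_on UNIV f" and u: "u \<in> subdifferential f x"
    and c: "f c \<le> 0" and pos: "f x > 0"
  shows "f (x - f x / \<bar>u\<bar>\<^sup>2 * u) \<le> f x"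
proof -
  have "f x + u * (c - x) \<le> f c"
    using u by (simp add: subdifferential_def)
  with c have le: "f x \<le> u * (x - c)" by (simp add: right_diff_distrib)
  with pos have prod_pos: "u * (x - c) > 0" by linarith
  then have nz: "u \<noteq> 0" "x - c \<noteq> 0" by auto
  \<comment> \<open>In one dimension the projector's step is \<open>f x / u\<close>, so
    \<open>t\<close> is the fraction of the way from \<open>x\<close> to \<open>c\<close> that it
    covers.\<close>
  define t where "t = f x / (u * (x - c))"
  \<comment> \<open>The bound \<open>t \<le> 1\<close>, no overshoot past \<open>c\<close>, is the
    subgradient inequality \<open>le\<close> divided by \<open>u * (x - c)\<close>.\<close>
  have t: "0 \<le> t" "t \<le> 1"
    using le pos prod_pos by (simp_all add: t_def)
  have "t * (x - c) = f x / \<bar>u\<bar>\<^sup>2 * u"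
    using nz by (simp add: t_def power2_eq_square)
  then have "x - f x / \<bar>u\<bar>\<^sup>2 * u = (1 - t) * x + t * c"
    by (simp add: algebra_simps)
  also have "f \<dots> \<le> (1 - t) * f x + t * f c"
    using convex_onD[OF conv t, of x c] by simp
  also have "\<dots> \<le> (1 - t) * f x + t * f x"
    using t c pos by (intro add_left_mono mult_left_mono) auto
  finally show ?thesis by (simp add: algebra_simps)
qed

theorem corollary9p3:
  fixes f :: "real \<Rightarrow> real" and C :: "real set"
  assumes "convex_on UNIV f"
    and "C = {x. f x \<le> 0}"
    and "C \<noteq> {}"
  shows "decreasing_property f"
proof -
  obtain c where c: "f c \<le> 0" using assms(2,3) by auto
  \<comment> \<open>Where \<open>f x \<le> 0\<close> the projector fixes \<open>x\<close>, so only
    the case \<open>f x > 0\<close> calls on the step estimate, with \<open>s x\<close> as the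
    subgradient.\<close>
  have "f (subgrad_projector f s x) \<le> f x" if "subdiff_selection f s" for s x
    using that subgrad_step_le[OF assms(1) _ c, of "s x" x]
    by (simp add: subgrad_projector_def subdiff_selection_def)
  then show ?thesis
    unfolding decreasing_property_def subgrad_projections_def
    by (auto intro!: SUP_least)
qed

end
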